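(* Let $a,b,c,d\in\mathbb R$ be admissible parameters (see context) with $c=0$ and $b-2d\neq0$, and let $\lambda>0$, $\sigma\neq0$, $m\in(0,1]$. Define $$j_0=\frac{a^2-\sigma^2(b-2d)\big(b-2d\,(1+2a\lambda^2(2m^2-1))\big)}{\sigma^2(b-2d)^2},\qquad j_2=-\frac{12\,a\,d\,\lambda^2m^2}{b-2d},$$ $$k_0=\frac{a+\sigma^2(b-2d)\big(1-4d\lambda^2(2m^2-1)\big)}{\sigma(b-2d)},\qquad k_2=12\,d\,\lambda^2m^2\sigma .$$ Then, with $\xi=x-\sigma t$, the functions $$\eta=j_0+j_2\,\mathrm{cn}^2(\lambda\xi,m),\qquad w=k_0+k_2\,\mathrm{cn}^2(\lambda\xi,m)$$ form a traveling-wave solution of the $abcd$-system (with $c=0$).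
   Context: The $abcd$-system for real-valued $\eta(x,t),w(x,t)$, $x,t\in\mathbb R$, is $$\eta_t+w_x+(w\eta)_x+a w_{xxx}-b\eta_{xxt}=0,\qquad w_t+\eta_x+ww_x+c\,\eta_{xxx}-d w_{xxt}=0 .$$ The real parameters $a,b,c,d$ are admissible if for some $\theta\in[0,1]$: $a+b=\tfrac12(\theta^2-\tfrac13)$, $c+d=\tfrac12(1-\theta^2)\ge 0$, and $a+b+c+d=\tfrac13$. Jacobi elliptic function convention: for $0\le m\le 1$, with $v=\int_0^\phi (1-m^2\sin^2 t)^{-1/2}dt$, one sets $\mathrm{cn}(v,m)=\cos\phi$; $m$ is the elliptic modulus (so $\mathrm{cn}(v,1)=\mathrm{sech}\,v$). *)

theory Defs
  imports "HOL-Analysis.Analysis"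
begin

definition elliptic_F :: "real \<Rightarrow> real \<Rightarrow> real" where
  "elliptic_F \<phi> m =
     (LBINT t = ereal 0..ereal \<phi>. 1 / sqrt (1 - m\<^sup>2 * (sin t)\<^sup>2))"

text \<open>
  The argument \<open>m\<close> is the elliptic modulus, not the parameter (its square); the definition is
  meant for \<open>0 \<le> m \<le> 1\<close>. For \<open>m = 1\<close> the integrand is \<open>1 / \<bar>cos t\<bar>\<close>, so the integral diverges
  unless \<open>\<bar>\<phi>\<bar> < pi / 2\<close>; the side condition keeps the default value of a divergent
  integral from being taken into account.
\<close>

definition jacobi_am :: "real \<Rightarrow> real \<Rightarrow> real" where
  "jacobi_am v m = (THE \<phi>. (m = 1 \<longrightarrow> \<bar>\<phi>\<bar> < pi / 2) \<and> v = elliptic_F \<phi> m)"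

definition jacobi_cn :: "real \<Rightarrow> real \<Rightarrow> real" where
  "jacobi_cn v m = cos (jacobi_am v m)"

definition admissible :: "real \<Rightarrow> real \<Rightarrow> real \<Rightarrow> real \<Rightarrow> bool" where
  "admissible a b c d \<longleftrightarrow>
     (\<exists>\<theta>\<in>{0..1}. a + b = 1/2 * (\<theta>\<^sup>2 - 1/3) \<and> c + d = 1/2 * (1 - \<theta>\<^sup>2) \<and> c + d \<ge> 0 \<and>
        a + b + c + d = 1/3)"

definition Dx :: "(real \<Rightarrow> real \<Rightarrow> real) \<Rightarrow> real \<Rightarrow> real \<Rightarrow> real" where
  "Dx f x t = deriv (\<lambda>y. f y t) x"

definition Dt :: "(real \<Rightarrow> real \<Rightarrow> real) \<Rightarrow> real \<Rightarrow> real \<Rightarrow> real" where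
  "Dt f x t = deriv (\<lambda>s. f x s) t"

text \<open>Functions of class \<open>C\<^sup>k\<close> on the \<open>(x, t)\<close>-plane.\<close>

fun Ck :: "nat \<Rightarrow> (real \<Rightarrow> real \<Rightarrow> real) \<Rightarrow> bool" where
  "Ck 0 f \<longleftrightarrow> continuous_on UNIV (\<lambda>(x, t). f x t)"
| "Ck (Suc k) f \<longleftrightarrow>
     (\<forall>x t. (\<lambda>y. f y t) differentiable (at x) \<and> (\<lambda>s. f x s) differentiable (at t)) \<and>
     Ck k (Dx f) \<and> Ck k (Dt f)"

text \<open>
  Classical solutions on the whole plane. The system is of third order, and \<open>C\<^sup>3\<close> regularity
  guarantees that every \<^const>\<open>deriv\<close> below is a genuine derivative.
\<close>

definition abcd_solution ::
  "real \<Rightarrow> real \<Rightarrow> real \<Rightarrow> real \<Rightarrow> (real \<Rightarrow> real \<Rightarrow> real) \<Rightarrow> (real \<Rightarrow> real \<Rightarrow> real) \<Rightarrow> bool" where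
  "abcd_solution a b c d \<eta> w \<longleftrightarrow>
     Ck 3 \<eta> \<and> Ck 3 w \<and>
     (\<forall>x t. Dt \<eta> x t + Dx w x t + Dx (\<lambda>x t. w x t * \<eta> x t) x t
              + a * Dx (Dx (Dx w)) x t - b * Dt (Dx (Dx \<eta>)) x t = 0) \<and>
     (\<forall>x t. Dt w x t + Dx \<eta> x t + w x t * Dx w x t
              + c * Dx (Dx (Dx \<eta>)) x t - d * Dt (Dx (Dx w)) x t = 0)"

definition traveling_wave_solution ::
  "real \<Rightarrow> real \<Rightarrow> real \<Rightarrow> real \<Rightarrow> real \<Rightarrow>
   (real \<Rightarrow> real \<Rightarrow> real) \<Rightarrow> (real \<Rightarrow> real \<Rightarrow> real) \<Rightarrow> bool" where
  "traveling_wave_solution a b c d \<sigma> \<eta> w \<longleftrightarrow>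
     abcd_solution a b c d \<eta> w \<and>
     (\<exists>f g. \<forall>x t. \<eta> x t = f (x - \<sigma> * t) \<and> w x t = g (x - \<sigma> * t))"

end

theory Submission
  imports Defs
begin

text \<open>
  On the interval where its integrand is smooth, \<open>F(\<cdot>, m)\<close> is a diffeomorphism onto the reals: for
  \<open>m < 1\<close> its derivative is at least 1, and for \<open>m = 1\<close> it equals \<open>artanh (sin \<phi>)\<close>. Hence the
  amplitude satisfies \<open>am' = sqrt (1 - m\<^sup>2 sin\<^sup>2 am)\<close>, and \<open>Y = cn\<^sup>2\<close> satisfies
  \<open>Y'' = 2 (1 - m\<^sup>2) + 4 (2 m\<^sup>2 - 1) Y - 6 m\<^sup>2 Y\<^sup>2\<close>. So \<open>Y'''\<close> is \<open>Y'\<close> times an affine function of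
  \<open>Y\<close>, and each equation of the system becomes \<open>Y' (p + q Y) = 0\<close>; the coefficients are chosen
  so that \<open>p = q = 0\<close>.
\<close>

section \<open>The elliptic integral and its inverse\<close>

text \<open>The maximal interval around 0 on which the integrand of \<^const>\<open>elliptic_F\<close> is smooth.\<close>
definition elliptic_domain :: "real \<Rightarrow> real set" where
  "elliptic_domain m = (if m = 1 then {- (pi / 2)<..<pi / 2} else UNIV)"

lemma open_elliptic_domain: "open (elliptic_domain m)"
  by (simp add: elliptic_domain_def)

lemma zero_in_elliptic_domain: "0 \<in> elliptic_domain m"
  by (simp add: elliptic_domain_def)

lemma segment_subset_elliptic_domain:
  assumes "x \<in> elliptic_domain m" "y \<in> elliptic_domain m"
  shows "{x..y} \<subseteq> elliptic_domain m"
  using assms by (auto simp: elliptic_domain_def split: if_splits)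

text \<open>For \<open>m = 1\<close> the radicand is the square of the cosine, which is positive on
  the open interval; for \<open>m < 1\<close> it is at least \<open>1 - m\<^sup>2\<close>.\<close>

lemma elliptic_radicand_pos:
  assumes "0 < m" "m \<le> 1" "\<phi> \<in> elliptic_domain m"
  shows "0 < 1 - m\<^sup>2 * (sin \<phi>)\<^sup>2"
proof (cases "m = 1")
  case True
  then have "cos \<phi> > 0"
    using assms by (auto simp: elliptic_domain_def intro!: cos_gt_zero_pi)
  then show ?thesis
    using True by (simp add: cos_squared_eq[symmetric])
next
  case False
  then have "m\<^sup>2 < 1"
    using assms by (simp add: power_less_one_iff)
  moreover have "m\<^sup>2 * (sin \<phi>)\<^sup>2 \<le> m\<^sup>2 * 1"
    by (intro mult_left_mono) (auto simp: abs_square_le_1)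
  ultimately show ?thesis
    by simp
qed

lemma DERIV_elliptic_F:
  assumes "0 < m" "m \<le> 1" "\<phi> \<in> elliptic_domain m"
  shows "((\<lambda>u. elliptic_F u m) has_real_derivative 1 / sqrt (1 - m\<^sup>2 * (sin \<phi>)\<^sup>2)) (at \<phi>)"
proof -
  obtain e where e: "e > 0" "cball \<phi> e \<subseteq> elliptic_domain m"
    using open_contains_cball open_elliptic_domain assms(3) by blast
  obtain e0 where e0: "e0 > 0" "cball 0 e0 \<subseteq> elliptic_domain m"
    using open_contains_cball open_elliptic_domain zero_in_elliptic_domain by blast
  \<comment> \<open>The interval must contain the base point 0 of the integral and have
    \<open>\<phi>\<close> in its interior, so that the one-interval derivative from the fundamental
    theorem becomes a derivative at \<open>\<phi>\<close>.\<close>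
  define a b where "a = min (- e0) (\<phi> - e)" and "b = max e0 (\<phi> + e)"
  have ab: "a < 0" "0 < b" "a < \<phi>" "\<phi> < b"
    using e e0 by (auto simp: a_def b_def)
  have "\<phi> - e \<in> elliptic_domain m" "\<phi> + e \<in> elliptic_domain m"
       "- e0 \<in> elliptic_domain m" "e0 \<in> elliptic_domain m"
    using e e0 by (auto simp: subset_iff dist_real_def)
  then have "a \<in> elliptic_domain m" "b \<in> elliptic_domain m"
    by (auto simp: a_def b_def min_def max_def)
  then have sub: "{a..b} \<subseteq> elliptic_domain m"
    by (rule segment_subset_elliptic_domain)
  have "continuous_on {a..b} (\<lambda>t. 1 / sqrt (1 - m\<^sup>2 * (sin t)\<^sup>2))"
    using elliptic_radicand_pos[OF assms(1,2)] sub
    by (intro continuous_intros) (auto simp: less_le)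
  from interval_integral_FTC2[of a 0 b, OF _ _ this, of \<phi>] ab
  have "((\<lambda>u. elliptic_F u m) has_vector_derivative 1 / sqrt (1 - m\<^sup>2 * (sin \<phi>)\<^sup>2))
          (at \<phi> within {a..b})"
    by (simp add: elliptic_F_def)
  then show ?thesis
    using ab at_within_Icc_at[of a \<phi> b] by (simp add: has_real_derivative_iff_has_vector_derivative)
qed

lemma strict_mono_on_elliptic_F:
  assumes "0 < m" "m \<le> 1"
  shows "strict_mono_on (elliptic_domain m) (\<lambda>\<phi>. elliptic_F \<phi> m)"
proof (rule strict_mono_onI)
  fix x y assume xy: "x \<in> elliptic_domain m" "y \<in> elliptic_domain m" "x < y"
  show "elliptic_F x m < elliptic_F y m"
  proof (rule DERIV_pos_imp_increasing[OF xy(3)])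
    fix z assume "x \<le> z" "z \<le> y"
    then have "z \<in> elliptic_domain m"
      using segment_subset_elliptic_domain[OF xy(1,2)] by auto
    then show "\<exists>y. DERIV (\<lambda>\<phi>. elliptic_F \<phi> m) z :> y \<and> y > 0"
      using DERIV_elliptic_F[OF assms] elliptic_radicand_pos[OF assms] by force
  qed
qed

lemma elliptic_F_zero [simp]: "elliptic_F 0 m = 0"
  by (simp add: elliptic_F_def zero_ereal_def[symmetric])

text \<open>Both sides vanish at 0 and have derivative \<open>1 / cos\<close> on the interval, so
  their difference is constantly 0. The closed form makes surjectivity explicit when
  \<open>m = 1\<close>.\<close>

lemma elliptic_F_one:
  assumes "\<bar>\<phi>\<bar> < pi / 2"
  shows "elliptic_F \<phi> 1 = artanh (sin \<phi>)"
proof -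
  have "\<exists>k. \<forall>u\<in>elliptic_domain 1. elliptic_F u 1 - artanh (sin u) = k"
  proof (rule has_field_derivative_zero_constant)
    show "convex (elliptic_domain 1)"
      by (simp add: elliptic_domain_def)
    fix u assume u: "u \<in> elliptic_domain 1"
    then have c: "cos u > 0"
      by (auto simp: elliptic_domain_def intro!: cos_gt_zero_pi)
    then have "\<bar>sin u\<bar> < 1"
      by (simp add: abs_square_less_1[symmetric] sin_squared_eq)
    then have "((\<lambda>u. artanh (sin u)) has_real_derivative 1 / cos u) (at u)"
      using c DERIV_chain2[OF artanh_real_has_field_derivative DERIV_sin, of u]
      by (simp add: cos_squared_eq[symmetric]) (simp add: power2_eq_square)
    moreover have "((\<lambda>u. elliptic_F u 1) has_real_derivative 1 / cos u) (at u)"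
      using DERIV_elliptic_F[of 1 u] u c by (simp add: cos_squared_eq[symmetric])
    ultimately have "((\<lambda>u. elliptic_F u 1 - artanh (sin u)) has_real_derivative 0) (at u)"
      using DERIV_diff by fastforce
    then show "((\<lambda>u. elliptic_F u 1 - artanh (sin u)) has_real_derivative 0)
                 (at u within elliptic_domain 1)"
      by (rule has_field_derivative_at_within)
  qed
  then have "elliptic_F \<phi> 1 - artanh (sin \<phi>) = elliptic_F 0 1 - artanh (sin 0)"
    using assms zero_in_elliptic_domain[of 1]
    by (smt (verit, ccfv_threshold) elliptic_domain_def greaterThanLessThan_iff)
  then show ?thesis
    by simp
qed

text \<open>The integrand is at least 1, so \<open>elliptic_F u m - u\<close> is nondecreasing in
  \<open>u\<close>. This growth bound yields surjectivity for \<open>m < 1\<close>.\<close>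

lemma elliptic_F_diff_ge:
  assumes "0 < m" "m < 1" "x \<le> y"
  shows "y - x \<le> elliptic_F y m - elliptic_F x m"
proof -
  have "elliptic_F x m - x \<le> elliptic_F y m - y"
  proof (rule DERIV_nonneg_imp_nondecreasing[OF assms(3)])
    fix z
    have z: "z \<in> elliptic_domain m"
      using assms by (simp add: elliptic_domain_def)
    then have "0 < 1 - m\<^sup>2 * (sin z)\<^sup>2"
      using elliptic_radicand_pos[of m z] assms by simp
    then have "1 \<le> 1 / sqrt (1 - m\<^sup>2 * (sin z)\<^sup>2)"
      by (simp add: field_simps)
    moreover have "((\<lambda>u. elliptic_F u m - u) has_real_derivative
                     1 / sqrt (1 - m\<^sup>2 * (sin z)\<^sup>2) - 1) (at z)"
      using DERIV_elliptic_F[of m z] z assms by (auto intro!: derivative_eq_intros)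
    ultimately show "\<exists>y. ((\<lambda>u. elliptic_F u m - u) has_real_derivative y) (at z) \<and> 0 \<le> y"
      by force
  qed
  then show ?thesis
    by simp
qed

lemma elliptic_F_surj:
  assumes "0 < m" "m \<le> 1"
  shows "\<exists>\<phi>\<in>elliptic_domain m. elliptic_F \<phi> m = v"
proof (cases "m = 1")
  case True
  \<comment> \<open>The preimage of \<open>v\<close> is its Gudermannian
    \<open>arcsin (tanh v)\<close>, which inverts the closed form of \<open>elliptic_F\<close> at
    \<open>m = 1\<close>.\<close>
  have t: "-1 < tanh v" "tanh v < 1"
    by (simp_all add: tanh_real_lt_1 tanh_real_gt_neg1)
  then have "\<bar>arcsin (tanh v)\<bar> < pi / 2"
    using arcsin_lt_bounded[OF t] by auto
  then show ?thesis
    using True t elliptic_F_one[of "arcsin (tanh v)"]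
    by (intro bexI[of _ "arcsin (tanh v)"]) (auto simp: elliptic_domain_def artanh_tanh_real)
next
  case False
  then have D: "elliptic_domain m = UNIV" and m: "m < 1"
    using assms by (auto simp: elliptic_domain_def)
  have "continuous_on UNIV (\<lambda>\<phi>. elliptic_F \<phi> m)"
    using DERIV_elliptic_F[OF assms] D
    by (auto intro!: continuous_at_imp_continuous_on DERIV_isCont)
  \<comment> \<open>Comparison with the value 0 at 0 brackets \<open>v\<close> between the values at
    the two endpoints, as the intermediate value theorem requires.\<close>
  moreover have "- \<bar>v\<bar> \<ge> elliptic_F (- \<bar>v\<bar>) m" "elliptic_F \<bar>v\<bar> m \<ge> \<bar>v\<bar>"
    using elliptic_F_diff_ge[OF assms(1) m, of "- \<bar>v\<bar>" 0]
          elliptic_F_diff_ge[OF assms(1) m, of 0 "\<bar>v\<bar>"] by auto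
  ultimately have "\<exists>x. - \<bar>v\<bar> \<le> x \<and> x \<le> \<bar>v\<bar> \<and> elliptic_F x m = v"
    by (intro IVT') (auto intro: continuous_on_subset)
  then show ?thesis
    using D by auto
qed

section \<open>The Jacobi amplitude\<close>

text \<open>The side condition in the definite description is exactly membership in
  \<open>elliptic_domain m\<close>, where strict monotonicity makes the solution unique.\<close>

lemma jacobi_am_eqI:
  assumes "0 < m" "m \<le> 1" "\<phi> \<in> elliptic_domain m"
  shows "jacobi_am (elliptic_F \<phi> m) m = \<phi>"
proof -
  have dom: "(m = 1 \<longrightarrow> \<bar>\<psi>\<bar> < pi / 2) \<longleftrightarrow> \<psi> \<in> elliptic_domain m" for \<psi>
    by (auto simp: elliptic_domain_def)
  show ?thesis
    unfolding jacobi_am_def dom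
    using assms(3) strict_mono_on_imp_inj_on[OF strict_mono_on_elliptic_F[OF assms(1,2)]]
    by (intro the_equality) (auto dest: inj_onD)
qed

lemma jacobi_am_in_domain:
  assumes "0 < m" "m \<le> 1"
  shows "jacobi_am v m \<in> elliptic_domain m" and "elliptic_F (jacobi_am v m) m = v"
  using elliptic_F_surj[OF assms, of v] jacobi_am_eqI[OF assms] by auto

text \<open>Inverse function theorem on the open domain, where the amplitude is a left inverse of
  \<open>elliptic_F\<close>: the derivative is the reciprocal of the integrand.\<close>

lemma DERIV_jacobi_am:
  assumes "0 < m" "m \<le> 1"
  shows "((\<lambda>v. jacobi_am v m) has_real_derivative sqrt (1 - m\<^sup>2 * (sin (jacobi_am v m))\<^sup>2)) (at v)"
proof -
  let ?f = "\<lambda>\<phi>. elliptic_F \<phi> m" and ?D = "elliptic_domain m" and ?a = "jacobi_am v m"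
  note am = jacobi_am_in_domain[OF assms, of v]
  have pos: "0 < 1 - m\<^sup>2 * (sin ?a)\<^sup>2"
    by (rule elliptic_radicand_pos[OF assms am(1)])
  have cont: "continuous_on ?D ?f"
    using DERIV_elliptic_F[OF assms] by (auto intro!: continuous_at_imp_continuous_on DERIV_isCont)
  have "((\<lambda>v. jacobi_am v m) has_derivative (*) (sqrt (1 - m\<^sup>2 * (sin ?a)\<^sup>2))) (at v)"
  proof (rule has_derivative_inverse_strong_x[of ?D "\<lambda>v. jacobi_am v m" v ?f])
    show "(?f has_derivative (*) (1 / sqrt (1 - m\<^sup>2 * (sin ?a)\<^sup>2))) (at ?a)"
      using DERIV_elliptic_F[OF assms am(1)] by (simp add: has_field_derivative_def)
  qed (use open_elliptic_domain am cont pos jacobi_am_eqI[OF assms] in \<open>auto simp: fun_eq_iff\<close>)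
  then show ?thesis
    by (simp add: has_field_derivative_def)
qed

lemma jacobi_cn_squared_ode:
  assumes "0 < m" "m \<le> 1"
  obtains Y' where
    "\<And>v. ((\<lambda>v. (jacobi_cn v m)\<^sup>2) has_real_derivative Y' v) (at v)"
    "\<And>v. (Y' has_real_derivative 2 * (1 - m\<^sup>2) + 4 * (2 * m\<^sup>2 - 1) * (jacobi_cn v m)\<^sup>2
             - 6 * m\<^sup>2 * ((jacobi_cn v m)\<^sup>2)\<^sup>2) (at v)"
proof
  define sn where "sn = (\<lambda>v. sin (jacobi_am v m))"
  define cn where "cn = (\<lambda>v. jacobi_cn v m)"
  define dn where "dn = (\<lambda>v. sqrt (1 - m\<^sup>2 * (sn v)\<^sup>2))"
  have pos: "0 < 1 - m\<^sup>2 * (sn v)\<^sup>2" for v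
    unfolding sn_def by (rule elliptic_radicand_pos[OF assms jacobi_am_in_domain(1)[OF assms]])
  have am: "((\<lambda>v. jacobi_am v m) has_real_derivative dn v) (at v)" for v
    unfolding dn_def sn_def by (rule DERIV_jacobi_am[OF assms])
  have sn: "(sn has_real_derivative cn v * dn v) (at v)" for v
    unfolding sn_def cn_def jacobi_cn_def by (auto intro!: derivative_eq_intros am)
  have cn: "(cn has_real_derivative - sn v * dn v) (at v)" for v
    unfolding sn_def cn_def jacobi_cn_def by (auto intro!: derivative_eq_intros am)
  have dn: "(dn has_real_derivative - m\<^sup>2 * sn v * cn v) (at v)" for v
    unfolding dn_def using pos[of v]
    by (auto intro!: derivative_eq_intros sn simp: dn_def)
  show "((\<lambda>v. (jacobi_cn v m)\<^sup>2) has_real_derivative - 2 * cn v * sn v * dn v) (at v)" for v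
    unfolding cn_def[symmetric] fun_cong[OF cn_def, symmetric]
    by (auto intro!: derivative_eq_intros cn)
  \<comment> \<open>These two relations eliminate \<open>sn\<close> and \<open>dn\<close> from the
    second derivative and leave a polynomial in \<open>cn\<close>.\<close>
  have sq: "(dn v)\<^sup>2 = 1 - m\<^sup>2 * (sn v)\<^sup>2" "(sn v)\<^sup>2 = 1 - (cn v)\<^sup>2" for v
    using pos[of v] by (auto simp: dn_def sn_def cn_def jacobi_cn_def sin_squared_eq)
  have "- 2 * (- sn v * dn v) * sn v * dn v + - 2 * cn v * (cn v * dn v) * dn v
          + - 2 * cn v * sn v * (- m\<^sup>2 * sn v * cn v)
        = 2 * (1 - m\<^sup>2) + 4 * (2 * m\<^sup>2 - 1) * (cn v)\<^sup>2 - 6 * m\<^sup>2 * ((cn v)\<^sup>2)\<^sup>2" for v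
    using sq[of v] by algebra
  moreover have "((\<lambda>v. - 2 * cn v * sn v * dn v) has_real_derivative
          - 2 * (- sn v * dn v) * sn v * dn v + - 2 * cn v * (cn v * dn v) * dn v
          + - 2 * cn v * sn v * (- m\<^sup>2 * sn v * cn v)) (at v)" for v
    by (rule derivative_eq_intros sn cn dn refl | simp add: algebra_simps)+
  ultimately show "((\<lambda>v. - 2 * cn v * sn v * dn v) has_real_derivative
          2 * (1 - m\<^sup>2) + 4 * (2 * m\<^sup>2 - 1) * (jacobi_cn v m)\<^sup>2
             - 6 * m\<^sup>2 * ((jacobi_cn v m)\<^sup>2)\<^sup>2) (at v)" for v
    by (simp add: cn_def)
qed

section \<open>Wave profiles\<close>

text \<open>The offset \<open>A\<close> and factor \<open>C\<close> are parameters so that the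
  family is closed under \<open>Dx\<close> and \<open>Dt\<close>: each derivative is again a wave,
  with offset 0, a rescaled factor and the differentiated profile.\<close>

definition wave :: "real \<Rightarrow> real \<Rightarrow> real \<Rightarrow> real \<Rightarrow> (real \<Rightarrow> real) \<Rightarrow> real \<Rightarrow> real \<Rightarrow> real" where
  "wave l \<sigma> A C F x t = A + C * F (l * (x - \<sigma> * t))"

lemma DERIV_wave:
  assumes "\<And>z. (F has_real_derivative F' z) (at z)"
  shows "((\<lambda>x. wave l \<sigma> A C F x t) has_real_derivative wave l \<sigma> 0 (C * l) F' x t) (at x)"
    and "((\<lambda>t. wave l \<sigma> A C F x t) has_real_derivative wave l \<sigma> 0 (- C * l * \<sigma>) F' x t) (at t)"
  unfolding wave_def by (auto intro!: derivative_eq_intros DERIV_chain2[OF assms])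

lemma Dx_Dt_wave:
  assumes "\<And>z. (F has_real_derivative F' z) (at z)"
  shows "Dx (wave l \<sigma> A C F) = wave l \<sigma> 0 (C * l) F'"
    and "Dt (wave l \<sigma> A C F) = wave l \<sigma> 0 (- C * l * \<sigma>) F'"
  unfolding Dx_def Dt_def fun_eq_iff using DERIV_wave[OF assms] DERIV_imp_deriv by blast+

text \<open>Here \<open>H i\<close> is the \<open>i\<close>-th derivative of the profile. The
  induction shifts \<open>H\<close> by one index and varies \<open>A\<close> and \<open>C\<close>,
  since differentiation changes both.\<close>

lemma Ck_wave:
  assumes "\<And>i z. i < k \<Longrightarrow> (H i has_real_derivative H (Suc i) z) (at z)"
    and "continuous_on UNIV (H k)"
  shows "Ck k (wave l \<sigma> A C (H 0))"
  using assms
proof (induction k arbitrary: H A C)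
  case 0
  have "continuous_on UNIV (\<lambda>p. A + C * H 0 (l * (fst p - \<sigma> * snd p)))"
    by (intro continuous_intros continuous_on_compose2[OF 0(2)]) auto
  then show ?case
    by (simp add: wave_def case_prod_unfold)
next
  case (Suc k)
  have H: "\<And>z. (H 0 has_real_derivative H (Suc 0) z) (at z)"
    using Suc.prems(1) by auto
  have "Ck k (wave l \<sigma> 0 C' (H (Suc 0)))" for C'
    using Suc.IH[of "\<lambda>i. H (Suc i)"] Suc.prems by auto
  moreover have "(\<lambda>y. wave l \<sigma> A C (H 0) y t) differentiable (at x)"
    and "(\<lambda>s. wave l \<sigma> A C (H 0) x s) differentiable (at t)" for x t
    using DERIV_wave[OF H] unfolding real_differentiable_def by blast+
  ultimately show ?case
    by (simp add: Dx_Dt_wave[OF H])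
qed

section \<open>Matching coefficients in the two equations\<close>

theorem mainTheorem6:
  fixes a b c d l \<sigma> m j0 j2 k0 k2 :: real
    and \<eta> w :: "real \<Rightarrow> real \<Rightarrow> real"
  assumes "admissible a b c d"
    and "c = 0"
    and "b - 2 * d \<noteq> 0"
    and "l > 0"
    and "\<sigma> \<noteq> 0"
    and "0 < m" and "m \<le> 1"
    and "j0 = (a\<^sup>2 - \<sigma>\<^sup>2 * (b - 2*d) * (b - 2*d * (1 + 2*a*l\<^sup>2 * (2*m\<^sup>2 - 1))))
               / (\<sigma>\<^sup>2 * (b - 2*d)\<^sup>2)"
    and "j2 = - (12 * a * d * l\<^sup>2 * m\<^sup>2 / (b - 2*d))"
    and "k0 = (a + \<sigma>\<^sup>2 * (b - 2*d) * (1 - 4*d*l\<^sup>2 * (2*m\<^sup>2 - 1))) / (\<sigma> * (b - 2*d))"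
    and "k2 = 12 * d * l\<^sup>2 * m\<^sup>2 * \<sigma>"
    and "\<And>x t. \<eta> x t = j0 + j2 * (jacobi_cn (l * (x - \<sigma> * t)) m)\<^sup>2"
    and "\<And>x t. w x t = k0 + k2 * (jacobi_cn (l * (x - \<sigma> * t)) m)\<^sup>2"
  shows "traveling_wave_solution a b c d \<sigma> \<eta> w"
proof -
  obtain Y1 where Y1: "\<And>v. ((\<lambda>v. (jacobi_cn v m)\<^sup>2) has_real_derivative Y1 v) (at v)"
    and Y2: "\<And>v. (Y1 has_real_derivative 2 * (1 - m\<^sup>2) + 4 * (2 * m\<^sup>2 - 1) * (jacobi_cn v m)\<^sup>2
             - 6 * m\<^sup>2 * ((jacobi_cn v m)\<^sup>2)\<^sup>2) (at v)"
    using jacobi_cn_squared_ode[OF assms(6,7)] by metis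
  define Y where "Y = (\<lambda>v. (jacobi_cn v m)\<^sup>2)"
  define Y2 where "Y2 = (\<lambda>v. 2 * (1 - m\<^sup>2) + 4 * (2 * m\<^sup>2 - 1) * Y v - 6 * m\<^sup>2 * (Y v)\<^sup>2)"
  define Y3 where "Y3 = (\<lambda>v. (4 * (2 * m\<^sup>2 - 1) - 12 * m\<^sup>2 * Y v) * Y1 v)"
  define H where "H = (\<lambda>i. [Y, Y1, Y2, Y3] ! i)"
  have D: "(Y has_real_derivative Y1 v) (at v)" "(Y1 has_real_derivative Y2 v) (at v)" for v
    using Y1[of v] Y2[of v] by (simp_all add: Y_def Y2_def)
  have D3: "(Y2 has_real_derivative Y3 v) (at v)" for v
    unfolding Y2_def Y3_def by (auto intro!: derivative_eq_intros D simp: algebra_simps)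
  have "continuous_on UNIV Y" "continuous_on UNIV Y1"
    using D by (auto intro!: continuous_at_imp_continuous_on DERIV_isCont)
  then have "continuous_on UNIV Y3"
    unfolding Y3_def by (intro continuous_intros)
  moreover have "(H i has_real_derivative H (Suc i) z) (at z)" if "i < 3" for i z
    using that D D3 by (auto simp: H_def less_Suc_eq numeral_3_eq_3)
  ultimately have Ck: "Ck 3 (wave l \<sigma> A C Y)" for A C
    using Ck_wave[of 3 H l \<sigma> A C] by (simp add: H_def del: Ck.simps)
  have \<eta>: "\<eta> = wave l \<sigma> j0 j2 Y" and w: "w = wave l \<sigma> k0 k2 Y"
    using assms by (auto simp: fun_eq_iff wave_def Y_def)
  \<comment> \<open>The product of the two profiles is itself a profile, so the nonlinear term
    \<open>(w\<eta>)_x\<close> falls under the same derivative rule for waves.\<close>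
  define P where "P = (\<lambda>v. (k0 + k2 * Y v) * (j0 + j2 * Y v))"
  have DP: "(P has_real_derivative k2 * Y1 v * (j0 + j2 * Y v) + (k0 + k2 * Y v) * (j2 * Y1 v)) (at v)" for v
    unfolding P_def by (auto intro!: derivative_eq_intros D)
  have w\<eta>: "(\<lambda>x t. w x t * \<eta> x t) = wave l \<sigma> 0 1 P"
    by (simp add: fun_eq_iff \<eta> w wave_def P_def)
  \<comment> \<open>Writing \<open>b\<close> as \<open>B + 2 * d\<close> turns the denominators of
    the coefficients into monomials in \<open>B\<close> and \<open>\<sigma>\<close>, both
    nonzero.\<close>
  define B \<mu> where "B = b - 2 * d" and "\<mu> = 2 * m\<^sup>2 - 1"
  have B: "B \<noteq> 0" "b = B + 2 * d"
    using assms by (auto simp: B_def)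
  note vals = assms(8-11)[folded B_def \<mu>_def]
  \<comment> \<open>\<open>e1\<close>--\<open>e4\<close>: vanishing of the coefficients of \<open>Y Y'\<close> and \<open>Y'\<close> in the two equations\<close>
  have e1: "2 * k2 * j2 = 12 * m\<^sup>2 * l\<^sup>2 * (a * k2 + b * \<sigma> * j2)"
    using B(1) unfolding vals B(2) by (simp add: field_simps power2_eq_square)
  have e2: "- \<sigma> * j2 + k2 + k0 * j2 + k2 * j0 + 4 * \<mu> * l\<^sup>2 * (a * k2 + b * \<sigma> * j2) = 0"
    using B(1) assms(5) unfolding vals B(2) by (simp add: field_simps power2_eq_square)
  have e3: "k2\<^sup>2 = 12 * m\<^sup>2 * l\<^sup>2 * d * \<sigma> * k2"
    unfolding vals by (simp add: power2_eq_square)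
  have e4: "- \<sigma> * k2 + j2 + k0 * k2 + 4 * \<mu> * l\<^sup>2 * d * \<sigma> * k2 = 0"
    using B(1) assms(5) unfolding vals B(2) by (simp add: field_simps power2_eq_square)
  \<comment> \<open>With \<open>y\<close> and \<open>y1\<close> for the values of \<open>Y\<close>
    and \<open>Y1\<close>, the left side is \<open>l * y1\<close> times the left side of
    \<open>e2\<close>, plus \<open>l * y1 * y\<close> times the difference of the two sides of
    \<open>e1\<close>. The second equation splits in the same way over \<open>e4\<close> and
    \<open>e3\<close>.\<close>
  have "- j2 * l * \<sigma> * y1 + k2 * l * y1 + l * (k2 * y1 * (j0 + j2 * y) + (k0 + k2 * y) * (j2 * y1))
          + a * (k2 * l * l * l * ((4 * \<mu> - 12 * m\<^sup>2 * y) * y1))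
          + b * (j2 * l * l * l * \<sigma> * ((4 * \<mu> - 12 * m\<^sup>2 * y) * y1)) = 0" for y y1
    using e1 e2 by algebra
  moreover have "- k2 * l * \<sigma> * y1 + j2 * l * y1 + (k0 + k2 * y) * (k2 * l * y1)
          + d * (k2 * l * l * l * \<sigma> * ((4 * \<mu> - 12 * m\<^sup>2 * y) * y1)) = 0" for y y1
    using e3 e4 by algebra
  ultimately have "abcd_solution a b c d \<eta> w"
    unfolding abcd_solution_def w\<eta>
    by (simp add: \<eta> w Ck Dx_Dt_wave[OF D(1)] Dx_Dt_wave[OF D(2)] Dx_Dt_wave[OF D3]
          Dx_Dt_wave[OF DP] assms(2))
       (simp add: wave_def Y3_def \<mu>_def eq_neg_iff_add_eq_0)
  moreover have "\<exists>f g. \<forall>x t. \<eta> x t = f (x - \<sigma> * t) \<and> w x t = g (x - \<sigma> * t)"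
    unfolding \<eta> w wave_def
    by (intro exI[of _ "\<lambda>z. j0 + j2 * Y (l * z)"] exI[of _ "\<lambda>z. k0 + k2 * Y (l * z)"]) simp
  ultimately show ?thesis
    unfolding traveling_wave_solution_def by blast
qed

end
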